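(* Let $F:\mathbb{R}/\mathbb{Z}\to\mathbb{R}\cup\{\pm\infty\}$ be a Borel measurable function that is finite almost everywhere. Then there exist real numbers $\{c(\beta):\beta\in\mathbb{Q}/\mathbb{Z}\}$ such that $$\lim_{N\to\infty}\sum_{n=1}^N(-1)^{n-1}q_{n-1}(\alpha)\sum_{\beta\in E_n(\alpha)}c(\beta)=F(\alpha)$$ for almost all irrational points $\alpha\in\mathbb{R}/\mathbb{Z}$. Here "almost all" refers to Haar (Lebesgue) measure.
   Context: Identify an irrational $\alpha\in\mathbb{R}/\mathbb{Z}$ with its representative in $(0,1)$. Write $\alpha=[0;a_1,a_2,\dots]$ for its simple continued fraction expansion. Set $p_{-2}=0$, $q_{-2}=1$, $p_{-1}=1$, $q_{-1}=0$, and for $n\ge0$ set $p_n=a_np_{n-1}+p_{n-2}$ and $q_n=a_nq_{n-1}+q_{n-2}$, with $a_0=0$. For $n\ge1$, $$E_n(\alpha)=\left\{\frac{mp_{n-1}+p_{n-2}}{mq_{n-1}+q_{n-2}}:m=1,\dots,a_n\right\}\subset\mathbb{Q}/\mathbb{Z}.$$ These are the convergents and intermediate convergents of $\alpha$. *)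

theory Defs
  imports "HOL-Analysis.Analysis"
begin

section \<open>The circle \<open>\<real>/\<int>\<close>\<close>

quotient_type circle = real / "\<lambda>x y :: real. x - y \<in> \<int>"
  morphisms rep_circle circ
proof (rule equivpI)
  show "reflp (\<lambda>x y :: real. x - y \<in> \<int>)"
    by (simp add: reflp_def)
  show "symp (\<lambda>x y :: real. x - y \<in> \<int>)"
    by (rule sympI) (metis Ints_minus minus_diff_eq)
  show "transp (\<lambda>x y :: real. x - y \<in> \<int>)"
  proof (rule transpI)
    fix x y z :: real
    assume "x - y \<in> \<int>" "y - z \<in> \<int>"
    then have "(x - y) + (y - z) \<in> \<int>"
      by (rule Ints_add)
    then show "x - z \<in> \<int>"
      by simp
  qed
qed

instantiation circle :: topological_space
begin

definition open_circle :: "circle set \<Rightarrow> bool" where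
  "open_circle U \<longleftrightarrow> open (circ -` U)"

instance
  by standard (auto simp: open_circle_def vimage_Union)

end

lemma continuous_circ: "continuous_on UNIV circ"
  by (simp add: continuous_on_open_vimage open_circle_def)

lemma measurable_circ [measurable]: "circ \<in> borel_measurable borel"
  by (rule borel_measurable_continuous_onI[OF continuous_circ])

definition haar :: "circle measure" where
  "haar = distr (restrict_space lborel {0..<1}) borel circ"

lift_definition circ_repr :: "circle \<Rightarrow> real" is frac
proof -
  fix x y :: real
  assume "x - y \<in> \<int>"
  then obtain k where "x = y + of_int k"
    by (metis Ints_cases add.commute diff_add_cancel)
  then show "frac x = frac y"
    by (simp add: frac_def)
qed

definition rat_circle :: "circle set" where
  "rat_circle = circ ` \<rat>"


section \<open>Continued fractions\<close>

text \<open>For \<open>n \<ge> 1\<close> the partial quotient \<open>a\<^sub>n\<close> of an irrational \<open>x \<in> (0,1)\<close> is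
  \<open>\<lfloor>1 / T\<^sup>n\<^sup>-\<^sup>1 x\<rfloor>\<close>, where \<open>T\<close> is the Gauss map.\<close>

definition gauss_map :: "real \<Rightarrow> real" where
  "gauss_map x = frac (1 / x)"

fun cf_digit :: "circle \<Rightarrow> nat \<Rightarrow> int" where
  "cf_digit \<alpha> 0 = 0"
| "cf_digit \<alpha> (Suc n) = \<lfloor>1 / (gauss_map ^^ n) (circ_repr \<alpha>)\<rfloor>"

text \<open>The indices of the recursions for \<open>p\<close> and \<open>q\<close> are shifted by two:
  \<open>cf_p \<alpha> (n + 2)\<close> is \<open>p\<^sub>n\<close> and \<open>cf_q \<alpha> (n + 2)\<close> is \<open>q\<^sub>n\<close>, for \<open>n \<ge> -2\<close>.\<close>

fun cf_p :: "circle \<Rightarrow> nat \<Rightarrow> int" where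
  "cf_p \<alpha> 0 = 0"
| "cf_p \<alpha> (Suc 0) = 1"
| "cf_p \<alpha> (Suc (Suc n)) = cf_digit \<alpha> n * cf_p \<alpha> (Suc n) + cf_p \<alpha> n"

fun cf_q :: "circle \<Rightarrow> nat \<Rightarrow> int" where
  "cf_q \<alpha> 0 = 1"
| "cf_q \<alpha> (Suc 0) = 0"
| "cf_q \<alpha> (Suc (Suc n)) = cf_digit \<alpha> n * cf_q \<alpha> (Suc n) + cf_q \<alpha> n"

definition cf_E :: "nat \<Rightarrow> circle \<Rightarrow> circle set" where
  "cf_E n \<alpha> =
     (\<lambda>m. circ (of_int (m * cf_p \<alpha> (n + 1) + cf_p \<alpha> n) /
                of_int (m * cf_q \<alpha> (n + 1) + cf_q \<alpha> n))) ` {1..cf_digit \<alpha> n}"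

lemma cf_E_subset: "cf_E n \<alpha> \<subseteq> rat_circle"
  by (auto simp: cf_E_def rat_circle_def intro!: imageI Rats_divide simp del: of_int_add of_int_mult)

end

theory Submission
  imports Defs
begin

text \<open>
  Only the first element of \<open>E\<^sub>n\<^sub>+\<^sub>1(\<alpha>)\<close> occurs already among the fractions attached to the previous
  level. Hence on each cylinder of order \<open>n\<close> the values of the partial sum of order \<open>n + 1\<close> can be
  prescribed freely on all subcylinders with digit at least \<open>2\<close>; on the subcylinder with digit \<open>1\<close>
  the value is forced. If the same target \<open>t\<close> is prescribed on successive levels, the sum equals \<open>t\<close>
  from the first digit different from \<open>1\<close> on, and each earlier digit \<open>1\<close> multiplies the distance to
  \<open>t\<close> by at most \<open>3\<close>, since \<open>q\<^sub>n \<le> 2 q\<^sub>n\<^sub>-\<^sub>1\<close> when \<open>a\<^sub>n = 1\<close>.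

  Choose cylinder functions \<open>t\<^sub>k\<close> of order \<open>N\<^sub>k\<close> with \<open>|F - t\<^sub>k| \<le> 9\<^sup>-\<^sup>k\<close> off a set of measure at
  most \<open>2\<^sup>-\<^sup>k\<close>, and use \<open>t\<^sub>k\<close> as the target on the levels from \<open>N\<^sub>k\<close> to \<open>N\<^sub>k\<^sub>+\<^sub>1\<close>. A digit \<open>1\<close> takes up at
  most half of a cylinder, so the points with \<open>k\<close> ones after level \<open>N\<^sub>k\<close> have measure at most
  \<open>2\<^sup>-\<^sup>k\<close>. By Borel-Cantelli almost every point eventually avoids both exceptional sets, and then
  the partial sums in the \<open>k\<close>th block stay within a constant times \<open>3\<^sup>k 9\<^sup>-\<^sup>k\<close> of \<open>F\<close>.
\<close>

section \<open>Continued fraction words\<close>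

text \<open>Words list the partial quotients in reverse order, \<open>a\<^sub>n # \<dots> # a\<^sub>1\<close>, so that passing to a
  subcylinder is \<open>Cons\<close>. On such a word \<open>continuant\<close> is \<open>q\<^sub>n\<close>, \<open>prev_continuant\<close> is \<open>q\<^sub>n\<^sub>-\<^sub>1\<close>, and
  \<open>cf_eval\<close> at \<open>y\<close> is \<open>[0; a\<^sub>1, \<dots>, a\<^sub>n + y]\<close>.\<close>

fun continuant :: "int list \<Rightarrow> real" where
  "continuant [] = 1"
| "continuant [a] = of_int a"
| "continuant (a # b # w) = of_int a * continuant (b # w) + continuant w"

fun prev_continuant :: "int list \<Rightarrow> real" where
  "prev_continuant [] = 0"
| "prev_continuant (a # w) = continuant w"

fun cf_eval :: "int list \<Rightarrow> real \<Rightarrow> real" where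
  "cf_eval [] y = y"
| "cf_eval (a # w) y = cf_eval w (1 / (of_int a + y))"

abbreviation digits :: "int list \<Rightarrow> bool" where
  "digits w \<equiv> \<forall>a\<in>set w. 1 \<le> a"

lemma continuant_Cons: "continuant (a # w) = of_int a * continuant w + prev_continuant w"
  by (cases w) auto

lemma continuant_bounds:
  "digits w \<Longrightarrow> 1 \<le> continuant w \<and> length w \<le> continuant w \<and>
     0 \<le> prev_continuant w \<and> prev_continuant w \<le> continuant w \<and> (w \<noteq> [] \<longrightarrow> 1 \<le> prev_continuant w)"
proof (induction w)
  case (Cons a w)
  then have IH: "1 \<le> continuant w" "length w \<le> continuant w" "0 \<le> prev_continuant w"
      "w \<noteq> [] \<longrightarrow> 1 \<le> prev_continuant w" and a: "1 \<le> real_of_int a"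
    by auto
  then have le: "1 * continuant w \<le> of_int a * continuant w" by (intro mult_right_mono) auto
  have "1 + length w \<le> continuant (a # w)"
    using IH le a by (cases "w = []") (simp, unfold continuant_Cons, linarith)
  moreover have "continuant w \<le> continuant (a # w)"
    using IH le unfolding continuant_Cons by linarith
  ultimately show ?case using IH by simp
qed auto

lemma continuant_pos: "digits w \<Longrightarrow> 0 < continuant w"
  using continuant_bounds by fastforce

lemma cf_eval_append: "cf_eval (u @ v) y = cf_eval v (cf_eval u y)"
  by (induction u arbitrary: y) auto

lemma cf_eval_pos: "digits w \<Longrightarrow> 0 < y \<Longrightarrow> 0 < cf_eval w y"
proof (induction w arbitrary: y)
  case (Cons a w)
  then have "0 < 1 / (of_int a + y)" by (auto intro!: divide_pos_pos add_pos_pos)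
  then show ?case using Cons by simp
qed auto

lemma cf_eval_less_1: "digits w \<Longrightarrow> 0 < y \<Longrightarrow> y < 1 \<Longrightarrow> cf_eval w y < 1"
proof (induction w arbitrary: y)
  case (Cons a w)
  then have "1 < of_int a + y" by (metis add_less_le_mono add.commute add_0 list.set_intros(1) of_int_1_le_iff)
  then have "0 < 1 / (of_int a + y)" "1 / (of_int a + y) < 1" by auto
  then show ?case using Cons by simp
qed auto

lemma cf_eval_le_1: "digits w \<Longrightarrow> 0 < y \<Longrightarrow> y \<le> 1 \<Longrightarrow> cf_eval w y \<le> 1"
proof (induction w arbitrary: y)
  case (Cons a w)
  then have "1 \<le> real_of_int a" by auto
  then have "1 \<le> of_int a + y" using Cons.prems by linarith
  then have "0 < 1 / (of_int a + y)" "1 / (of_int a + y) \<le> 1" by auto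
  then show ?case using Cons by simp
qed auto

lemma inverse_shift_eqD:
  fixes y z :: real
  assumes "1 / (of_int a + y) = 1 / (of_int b + z)"
    and "1 \<le> a" "1 \<le> b" "0 \<le> y" "y < 1" "0 \<le> z" "z < 1"
  shows "a = b \<and> y = z"
proof -
  have "of_int a + y = of_int b + z"
    using assms(1) by (metis div_by_1 divide_divide_eq_right mult_1)
  then have "\<lfloor>of_int a + y\<rfloor> = \<lfloor>of_int b + z\<rfloor>" by simp
  moreover have "\<lfloor>of_int a + y\<rfloor> = a" "\<lfloor>of_int b + z\<rfloor> = b"
    using assms by (simp_all only: floor_eq_iff) auto
  ultimately show ?thesis using \<open>of_int a + y = of_int b + z\<close> by auto
qed

text \<open>The head of a word is the innermost digit. Since \<open>1 / (of_int a + y)\<close> again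
  lies in \<open>(0,1)\<close>, the induction hypothesis settles the tails of the words first; then
  \<open>a\<close> is the integer part of \<open>of_int a + y\<close>.\<close>

lemma cf_eval_inj:
  assumes "cf_eval w y = cf_eval v z" "length w = length v" "digits w" "digits v"
    and "0 < y" "y < 1" "0 < z" "z < 1"
  shows "w = v \<and> y = z"
  using assms
proof (induction w v arbitrary: y z rule: list_induct2')
  case (4 a w b v)
  have ab: "1 \<le> a" "1 \<le> b" using 4 by auto
  have r: "0 < 1 / (of_int a + y)" "1 / (of_int a + y) < 1"
    using ab(1) 4(6,7) by (auto simp: field_simps intro: add_pos_pos)
  have s: "0 < 1 / (of_int b + z)" "1 / (of_int b + z) < 1"
    using ab(2) 4(8,9) by (auto simp: field_simps intro: add_pos_pos)
  have "w = v \<and> 1 / (of_int a + y) = 1 / (of_int b + z)"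
    using 4 r s by (intro "4.IH") auto
  then show ?case using inverse_shift_eqD[of a y b z] ab 4(6-9) by auto
qed auto

text \<open>A reversed word ends with its first partial quotients, so \<open>cf_eval_inj\<close>
  cancels all of \<open>w\<close> against the end \<open>t\<close> of \<open>v\<close>. What remains
  is \<open>1 / m = 1 / (k + y)\<close> with \<open>0 < y < 1\<close>, impossible for integers
  \<open>m\<close> and \<open>k\<close>. The bounds \<open>2 \<le> m\<close> and
  \<open>2 \<le> l\<close> keep the arguments strictly below 1.\<close>

lemma cf_eval_neq_longer:
  assumes "cf_eval w (1 / of_int m) = cf_eval v (1 / of_int l)" "length w < length v"
    and "digits w" "digits v" "2 \<le> m" "2 \<le> l"
  shows False
proof -
  define u t where "u = take (length v - length w) v" and "t = drop (length v - length w) v"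
  have v: "v = u @ t" "length t = length w" "u \<noteq> []"
    using assms(2) by (auto simp: u_def t_def)
  have d: "digits u" "digits t" using assms(4) unfolding v(1) by auto
  have l: "0 < 1 / real_of_int l" "1 / real_of_int l < 1" using assms(6) by auto
  have m: "0 < 1 / real_of_int m" "1 / real_of_int m < 1" using assms(5) by auto
  have "cf_eval w (1 / of_int m) = cf_eval t (cf_eval u (1 / of_int l))"
    using assms(1) unfolding v(1) by (simp add: cf_eval_append)
  then have "1 / of_int m = cf_eval u (1 / of_int l)"
    using cf_eval_inj[of w "1 / of_int m" t "cf_eval u (1 / of_int l)"] v(2) d assms(3) m
      cf_eval_pos[OF d(1) l(1)] cf_eval_less_1[OF d(1) l] by auto
  moreover obtain u' k where u: "u = u' @ [k]" using v(3) by (metis rev_exhaust)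
  ultimately have e: "1 / (of_int m + 0) = 1 / (of_int k + cf_eval u' (1 / of_int l))"
    by (simp add: cf_eval_append)
  have d': "digits u'" "1 \<le> k" using d unfolding u by auto
  show False
    using inverse_shift_eqD[OF e] assms(5) d' cf_eval_pos[OF d'(1) l(1)] cf_eval_less_1[OF d'(1) l]
    by auto
qed

text \<open>Uniqueness of finite expansions whose last partial quotient is at least 2. It makes the
  description in \<open>farey_coeff\<close> well defined.\<close>

lemma cf_eval_terminal_inj:
  assumes "cf_eval w (1 / of_int m) = cf_eval v (1 / of_int l)"
    and "digits w" "digits v" "2 \<le> m" "2 \<le> l"
  shows "w = v \<and> m = l"
proof -
  have "length w = length v"
    using cf_eval_neq_longer[OF assms(1)] cf_eval_neq_longer[OF assms(1)[symmetric]] assms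
    by (metis linorder_neqE_nat)
  then have "w = v \<and> 1 / real_of_int m = 1 / of_int l"
    using assms by (intro cf_eval_inj) auto
  then show ?thesis by auto
qed

text \<open>\<open>cf_eval w\<close> is a Moebius map with denominator
  \<open>q\<^sub>n + q\<^sub>n\<^sub>-\<^sub>1 y\<close> and determinant 1 or -1; the induction
  avoids naming the numerators. The formula yields cylinder lengths, injectivity in the last digit
  and the convergence of the convergents.\<close>

lemma cf_eval_diff:
  assumes "digits w" "0 \<le> y" "0 \<le> z"
  shows "\<bar>cf_eval w y - cf_eval w z\<bar> = \<bar>y - z\<bar> /
    ((continuant w + prev_continuant w * y) * (continuant w + prev_continuant w * z))"
  using assms
proof (induction w arbitrary: y z)
  case (Cons a w)
  let ?q = "continuant w" and ?r = "prev_continuant w"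
  have p: "0 < of_int a + y" "0 < of_int a + z" using Cons.prems by (auto intro: add_pos_nonneg)
  have q: "0 < ?q" "0 \<le> ?r" using Cons.prems continuant_bounds[of w] by auto
  have eq: "?q + ?r * (1 / (of_int a + t)) = (continuant (a # w) + prev_continuant (a # w) * t) / (of_int a + t)"
    if "0 < of_int a + t" for t
    using that by (simp add: continuant_Cons field_simps)
  have "1 / (of_int a + y) - 1 / (of_int a + z) = (z - y) / ((of_int a + y) * (of_int a + z))"
    using p by (simp add: field_simps)
  then have d: "\<bar>1 / (of_int a + y) - 1 / (of_int a + z)\<bar> = \<bar>y - z\<bar> / ((of_int a + y) * (of_int a + z))"
    using p by (simp add: abs_mult abs_minus_commute)
  have "\<bar>cf_eval (a # w) y - cf_eval (a # w) z\<bar> = \<bar>1 / (of_int a + y) - 1 / (of_int a + z)\<bar> /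
     ((?q + ?r * (1 / (of_int a + y))) * (?q + ?r * (1 / (of_int a + z))))"
    unfolding cf_eval.simps using Cons.prems p by (intro Cons.IH) auto
  also have "\<dots> = \<bar>y - z\<bar> / ((of_int a + y) * (of_int a + z)) /
     ((continuant (a # w) + prev_continuant (a # w) * y) / (of_int a + y) *
      ((continuant (a # w) + prev_continuant (a # w) * z) / (of_int a + z)))"
    unfolding d eq[OF p(1)] eq[OF p(2)] ..
  finally show ?case using p by simp
qed auto

text \<open>The map is increasing or decreasing according to the parity of the length; unordered
  segments absorb this alternation.\<close>

lemma cf_eval_between:
  assumes "digits w" "0 \<le> a" "a \<le> y" "y \<le> b"
  shows "cf_eval w y \<in> closed_segment (cf_eval w a) (cf_eval w b)"
  using assms
proof (induction w arbitrary: a y b)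
  case Nil then show ?case by (auto simp: closed_segment_eq_real_ivl)
next
  case (Cons d w)
  have "1 \<le> real_of_int d" using Cons.prems by auto
  then have "cf_eval w (1 / (of_int d + y)) \<in>
      closed_segment (cf_eval w (1 / (of_int d + b))) (cf_eval w (1 / (of_int d + a)))"
    using Cons.prems by (intro Cons.IH) (auto intro!: divide_left_mono)
  then show ?case by (simp add: closed_segment_commute)
qed

lemma cf_eval_surj_open_segment:
  assumes "digits w" "0 \<le> a" "a < b" "x \<in> open_segment (cf_eval w a) (cf_eval w b)"
  shows "\<exists>y. a < y \<and> y < b \<and> x = cf_eval w y"
  using assms
proof (induction w arbitrary: a b)
  case Nil then show ?case by (auto simp: open_segment_eq_real_ivl)
next
  case (Cons d w)
  have d: "1 \<le> real_of_int d" using Cons.prems by auto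
  have "\<exists>y. 1 / (of_int d + b) < y \<and> y < 1 / (of_int d + a) \<and> x = cf_eval w y"
    using Cons.prems d
    by (intro Cons.IH) (auto simp: open_segment_commute intro!: divide_strict_left_mono)
  then obtain y where y: "1 / (of_int d + b) < y" "y < 1 / (of_int d + a)" "x = cf_eval w y"
    by blast
  have p: "0 < y" by (rule less_trans[OF _ y(1)]) (use d Cons.prems in auto)
  have "a < 1 / y - of_int d" "1 / y - of_int d < b"
    using y p d Cons.prems by (simp_all add: field_simps)
  then show ?case using y(3) by (intro exI[of _ "1 / y - of_int d"]) auto
qed

section \<open>Digits of irrational numbers under the Gauss map\<close>

primrec cf_word :: "nat \<Rightarrow> real \<Rightarrow> int list" where
  "cf_word 0 x = []"
| "cf_word (Suc n) x = \<lfloor>1 / (gauss_map ^^ n) x\<rfloor> # cf_word n x"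

definition irr :: "real set" where "irr = {0<..<1} - \<rat>"

lemma gauss_map_irr: "x \<in> irr \<Longrightarrow> gauss_map x \<in> irr"
proof -
  assume x: "x \<in> irr"
  have 1: "1 / x \<notin> \<rat>"
    using x by (auto simp: irr_def divide_inverse)
  have "frac (1 / x) \<notin> \<rat>"
  proof
    assume "frac (1 / x) \<in> \<rat>"
    then have "frac (1 / x) + of_int \<lfloor>1 / x\<rfloor> \<in> \<rat>" by (intro Rats_add) auto
    then show False using 1 by (simp add: frac_def)
  qed
  moreover have "frac (1 / x) \<noteq> 0" using calculation by force
  ultimately show "gauss_map x \<in> irr"
    using frac_ge_0[of "1/x"] frac_lt_1[of "1/x"] unfolding gauss_map_def irr_def by auto
qed

lemma gauss_iter_irr: "x \<in> irr \<Longrightarrow> (gauss_map ^^ n) x \<in> irr"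
  by (induction n) (auto intro: gauss_map_irr)

lemma digit_ge_1: "x \<in> irr \<Longrightarrow> 1 \<le> \<lfloor>1 / (gauss_map ^^ n) x\<rfloor>"
  using gauss_iter_irr[of x n] by (auto simp: irr_def le_floor_iff field_simps)

lemma digits_cf_word: "x \<in> irr \<Longrightarrow> digits (cf_word n x)"
proof (induction n)
  case (Suc n)
  then show ?case using digit_ge_1[of x n] by (simp del: one_le_floor)
qed simp

lemma length_cf_word [simp]: "length (cf_word n x) = n"
  by (induction n) auto

lemma cf_eval_cf_word: "x \<in> irr \<Longrightarrow> cf_eval (cf_word n x) ((gauss_map ^^ n) x) = x"
proof (induction n)
  case (Suc n)
  have "of_int \<lfloor>1 / (gauss_map ^^ n) x\<rfloor> + gauss_map ((gauss_map ^^ n) x) = 1 / (gauss_map ^^ n) x"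
    by (simp add: gauss_map_def frac_def)
  then show ?case using Suc by simp
qed simp

lemma cf_word_unique:
  assumes "x \<in> irr" "x = cf_eval w y" "digits w" "0 < y" "y < 1"
  shows "cf_word (length w) x = w"
proof -
  have "(gauss_map ^^ length w) x \<in> irr" using assms(1) by (rule gauss_iter_irr)
  then show ?thesis
    using cf_eval_inj[of "cf_word (length w) x" "(gauss_map ^^ length w) x" w y]
      cf_eval_cf_word[OF assms(1), of "length w"] digits_cf_word[OF assms(1)] assms
    by (auto simp: irr_def)
qed

section \<open>Prescribing the partial sums\<close>

text \<open>The partial sum as a function of the digits when every subcylinder of \<open>w\<close> with digit at least \<open>2\<close> is
  given the value \<open>T w\<close>. For digit \<open>1\<close> there is no choice, since \<open>[0; \<dots>, b, 1] = [0; \<dots>, b + 1]\<close> and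
  the coefficient there was fixed one level earlier.\<close>

fun steer :: "(int list \<Rightarrow> real) \<Rightarrow> int list \<Rightarrow> real" where
  "steer T [] = 0"
| "steer T (a # w) = (if 2 \<le> a then T w else
     (case w of [] \<Rightarrow> 0
      | b # v \<Rightarrow> steer T w - continuant w / continuant v * (T v - steer T w)))"

text \<open>Solves for the coefficient of \<open>[0; \<dots>, m]\<close>: raising the last digit
  from \<open>m - 1\<close> to \<open>m\<close> adds \<open>(-1) ^ length w * continuant w\<close>
  times this coefficient to the partial sum.\<close>

definition word_coeff :: "(int list \<Rightarrow> real) \<Rightarrow> int \<Rightarrow> int list \<Rightarrow> real" where
  "word_coeff T m w = (-1) ^ length w / continuant w * (steer T (m # w) - steer T ((m - 1) # w))"

text \<open>The class of 0 is also that of \<open>1 = [0; 1]\<close>; its coefficient has to be 0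
  because \<open>steer T [1] = steer T []\<close>. Any other rational class is read off from its
  expansion ending in a digit at least 2.\<close>

definition farey_coeff :: "(int list \<Rightarrow> real) \<Rightarrow> circle \<Rightarrow> real" where
  "farey_coeff T \<beta> = (if circ_repr \<beta> = 0 then 0 else
     (THE r. \<exists>w m. digits w \<and> 2 \<le> m \<and> circ_repr \<beta> = cf_eval w (1 / of_int m) \<and> r = word_coeff T m w))"

lemma circ_repr_circ: "0 \<le> x \<Longrightarrow> x < 1 \<Longrightarrow> circ_repr (circ x) = x"
  by (simp add: circ_repr.abs_eq frac_eq)

lemma circ_circ_repr: "circ (circ_repr \<alpha>) = \<alpha>"
proof transfer
  fix x :: real show "frac x - x \<in> \<int>" by (simp add: frac_def)
qed

lemma circ_repr_bounds: "0 \<le> circ_repr \<alpha>" "circ_repr \<alpha> < 1"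
  by (transfer, simp add: frac_lt_1)+

lemma farey_coeff_cf_eval:
  assumes "digits w" "2 \<le> m"
  shows "farey_coeff T (circ (cf_eval w (1 / of_int m))) = word_coeff T m w"
proof -
  let ?x = "cf_eval w (1 / of_int m)"
  have x: "0 < ?x" "?x < 1" using assms by (auto intro!: cf_eval_pos cf_eval_less_1)
  then have r: "circ_repr (circ ?x) = ?x" by (intro circ_repr_circ) auto
  have "(THE r. \<exists>v l. digits v \<and> 2 \<le> l \<and> ?x = cf_eval v (1 / of_int l) \<and> r = word_coeff T l v) = word_coeff T m w"
    by (rule the_equality) (use assms cf_eval_terminal_inj in blast)+
  then show ?thesis using x r by (simp add: farey_coeff_def)
qed

lemma farey_coeff_1: "farey_coeff T (circ 1) = 0"
  by (simp add: farey_coeff_def circ_repr.abs_eq frac_def)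

text \<open>Telescoping in \<open>a\<close>: for \<open>m \<ge> 2\<close> the coefficients are
  defined by exactly these differences, so the substance is the term \<open>m = 1\<close>.\<close>

lemma steer_increment:
  assumes "digits w" "1 \<le> a"
  shows "(-1) ^ length w * continuant w * (\<Sum>m\<in>{1..a}. farey_coeff T (circ (cf_eval w (1 / of_int m))))
    = steer T (a # w) - steer T w"
proof -
  have q: "0 < continuant w" using assms by (simp add: continuant_pos)
  have s: "(-1) ^ length w * ((-1) ^ length w * y) = (y::real)" for y
    by (simp flip: mult.assoc power_mult_distrib)
  have first: "(-1) ^ length w * continuant w * farey_coeff T (circ (cf_eval w 1)) = steer T (1 # w) - steer T w"
  proof (cases w)
    case Nil then show ?thesis by (simp add: farey_coeff_1)
  next
    case (Cons k v)
    have v: "digits v" "1 \<le> k" using assms Cons by auto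
    \<comment> \<open>The coefficient was fixed one level earlier, where
      \<open>steer T ((k + 1) # v) = T v\<close>. The sign changes between \<open>length v\<close>
      and \<open>length w\<close>, and the factor \<open>continuant w / continuant v\<close>
      appears: this is the digit 1 clause of \<open>steer\<close>.\<close>
    have "cf_eval w 1 = cf_eval v (1 / of_int (k + 1))" using Cons by simp
    then have c: "farey_coeff T (circ (cf_eval w 1)) = word_coeff T (k + 1) v"
      using farey_coeff_cf_eval[of v "k + 1" T] v by simp
    have "continuant v \<noteq> 0" using continuant_pos[OF v(1)] by simp
    then show ?thesis unfolding c
      using v s Cons by (simp add: word_coeff_def field_simps)
  qed
  show ?thesis using assms(2)
  proof (induction a rule: int_ge_induct)
    case base show ?case using first by simp
  next
    case (step a)
    have "{1..a + 1} = insert (a + 1) {1..a}" using step by auto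
    then have "(\<Sum>m\<in>{1..a+1}. farey_coeff T (circ (cf_eval w (1 / of_int m)))) =
       word_coeff T (a + 1) w + (\<Sum>m\<in>{1..a}. farey_coeff T (circ (cf_eval w (1 / of_int m))))"
      using farey_coeff_cf_eval[OF assms(1), of "a + 1" T] step(1) by simp
    moreover have "(-1) ^ length w * continuant w * word_coeff T (a + 1) w = steer T ((a + 1) # w) - steer T (a # w)"
      using q s by (simp add: word_coeff_def del: steer.simps)
    ultimately show ?case using step.IH by (simp add: distrib_left del: steer.simps)
  qed
qed

section \<open>Identification with the given \<open>p\<^sub>n\<close>, \<open>q\<^sub>n\<close> and
  \<open>E\<^sub>n\<close>\<close>

lemma cf_q_eq_continuant:
  "of_int (cf_q \<alpha> (n + 2)) = continuant (cf_word n (circ_repr \<alpha>))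
    \<and> of_int (cf_q \<alpha> (n + 1)) = prev_continuant (cf_word n (circ_repr \<alpha>))"
  by (induction n) (auto simp: continuant_Cons)

lemma cf_eval_pq:
  fixes y :: real
  assumes "circ_repr \<alpha> \<in> irr" "0 < y"
  shows "cf_eval (cf_word n (circ_repr \<alpha>)) y =
    (of_int (cf_p \<alpha> (n + 2)) + of_int (cf_p \<alpha> (n + 1)) * y) /
    (of_int (cf_q \<alpha> (n + 2)) + of_int (cf_q \<alpha> (n + 1)) * y)"
  using assms(2)
proof (induction n arbitrary: y)
  case (Suc n)
  let ?a = "\<lfloor>1 / (gauss_map ^^ n) (circ_repr \<alpha>)\<rfloor>"
  have "1 \<le> real_of_int ?a" using digit_ge_1[OF assms(1)] by simp
  then have p: "0 < of_int ?a + y" using Suc.prems by linarith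
  have e: "r + s * (1 / (of_int ?a + y)) = (of_int ?a * r + s + r * y) / (of_int ?a + y)" for r s :: real
    using p by (simp add: field_simps)
  have "cf_eval (cf_word (Suc n) (circ_repr \<alpha>)) y =
    (of_int (cf_p \<alpha> (n + 2)) + of_int (cf_p \<alpha> (n + 1)) * (1 / (of_int ?a + y))) /
    (of_int (cf_q \<alpha> (n + 2)) + of_int (cf_q \<alpha> (n + 1)) * (1 / (of_int ?a + y)))"
    using Suc.IH[of "1 / (of_int ?a + y)"] p by simp
  then show ?case using p unfolding e by simp
qed auto

lemma cf_E_word:
  assumes "circ_repr \<alpha> \<in> irr"
  shows "cf_E (Suc n) \<alpha> = (\<lambda>m. circ (cf_eval (cf_word n (circ_repr \<alpha>)) (1 / of_int m))) `
     {1..\<lfloor>1 / (gauss_map ^^ n) (circ_repr \<alpha>)\<rfloor>}"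
  unfolding cf_E_def
proof (rule image_cong)
  fix m assume "m \<in> {1..\<lfloor>1 / (gauss_map ^^ n) (circ_repr \<alpha>)\<rfloor>}"
  then have m: "0 < real_of_int m" by simp
  have e: "r + s * (1 / of_int m) = (of_int m * r + s) / of_int m" for r s :: real
    using m by (simp add: field_simps)
  show "circ (of_int (m * cf_p \<alpha> (Suc n + 1) + cf_p \<alpha> (Suc n)) / of_int (m * cf_q \<alpha> (Suc n + 1) + cf_q \<alpha> (Suc n)))
    = circ (cf_eval (cf_word n (circ_repr \<alpha>)) (1 / of_int m))"
    using m cf_eval_pq[OF assms, of "1 / of_int m" n, unfolded e] by simp
qed simp

text \<open>Needed to turn the sum over the set \<open>cf_E\<close> into a sum over digits. The
  values lie in \<open>(0,1]\<close>, so congruence modulo 1 is equality, and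
  \<open>cf_eval_diff\<close> finishes.\<close>

lemma inj_circ_cf_eval:
  assumes "digits w"
  shows "inj_on (\<lambda>m. circ (cf_eval w (1 / of_int m))) {1..}"
proof (rule inj_onI)
  fix m l :: int
  assume ml: "m \<in> {1..}" "l \<in> {1..}"
    and eq: "circ (cf_eval w (1 / of_int m)) = circ (cf_eval w (1 / of_int l))"
  let ?x = "cf_eval w (1 / of_int m)" and ?z = "cf_eval w (1 / of_int l)"
  have xz: "0 < ?x" "?x \<le> 1" "0 < ?z" "?z \<le> 1"
    using assms ml by (auto intro!: cf_eval_pos cf_eval_le_1)
  have "?x - ?z \<in> \<int>" using eq by (simp add: circle.abs_eq_iff)
  then obtain i where "?x - ?z = of_int i" by (auto elim: Ints_cases)
  moreover have "\<bar>?x - ?z\<bar> < 1" using xz by auto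
  ultimately have "?x - ?z = 0" by auto
  then have "\<bar>1 / real_of_int m - 1 / of_int l\<bar> /
    ((continuant w + prev_continuant w * (1 / of_int m)) * (continuant w + prev_continuant w * (1 / of_int l))) = 0"
    using cf_eval_diff[OF assms, of "1 / of_int m" "1 / of_int l"] ml by simp
  moreover have "0 < continuant w + prev_continuant w * (1 / of_int k)" if "1 \<le> k" for k :: int
    using continuant_bounds[OF assms] that by (intro add_pos_nonneg) auto
  ultimately have "1 / real_of_int m = 1 / of_int l"
    using ml by (metis abs_eq_0_iff atLeast_iff divide_eq_0_iff eq_iff_diff_eq_0 less_irrefl mult_eq_0_iff)
  then show "m = l" by auto
qed

lemma partial_sum_eq_steer:
  assumes "circ_repr \<alpha> \<in> irr"
  shows "(\<Sum>n=1..N. (-1) ^ (n - 1) * of_int (cf_q \<alpha> (n + 1)) * (\<Sum>\<beta>\<in>cf_E n \<alpha>. farey_coeff T \<beta>))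
    = steer T (cf_word N (circ_repr \<alpha>))"
proof (induction N)
  case (Suc N)
  let ?w = "cf_word N (circ_repr \<alpha>)"
  have d: "digits ?w" using digits_cf_word[OF assms] .
  have "(\<Sum>\<beta>\<in>cf_E (Suc N) \<alpha>. farey_coeff T \<beta>) =
     (\<Sum>m\<in>{1..\<lfloor>1 / (gauss_map ^^ N) (circ_repr \<alpha>)\<rfloor>}. farey_coeff T (circ (cf_eval ?w (1 / of_int m))))"
    unfolding cf_E_word[OF assms]
    by (subst sum.reindex) (auto intro: inj_on_subset[OF inj_circ_cf_eval[OF d]])
  then show ?case
    using Suc steer_increment[OF d digit_ge_1[OF assms, of N], of T] cf_q_eq_continuant[of \<alpha> N]
    by (simp del: steer.simps cf_q.simps)
qed simp

section \<open>Measure of cylinders\<close>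

abbreviation unit_lebesgue :: "real measure" where
  "unit_lebesgue \<equiv> restrict_space lborel {0..<1}"

definition cylinder :: "int list \<Rightarrow> real set" where
  "cylinder w = {x \<in> irr. cf_word (length w) x = w}"

lemma irr_borel [measurable]: "irr \<in> sets borel"
proof -
  have "(\<rat> :: real set) \<in> sets borel" by (rule sets.countable[OF _ countable_rat]) simp
  then show ?thesis unfolding irr_def by (intro sets.Diff) simp_all
qed

lemma gauss_map_measurable [measurable]: "gauss_map \<in> borel_measurable borel"
  unfolding gauss_map_def frac_def by measurable

lemma gauss_iter_measurable [measurable]: "(gauss_map ^^ n) \<in> borel_measurable borel"
proof (induction n)
  case (Suc n)
  show ?case unfolding funpow.simps(2) by (rule measurable_comp[OF Suc gauss_map_measurable])
qed (simp add: id_def)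

lemma cf_word_eq_borel: "{x. cf_word n x = w} \<in> sets borel"
proof (induction n arbitrary: w)
  case (Suc n)
  have [measurable]: "Measurable.pred borel (\<lambda>x. cf_word n x = v)" for v
    using Suc[of v] by (simp add: pred_def)
  show ?case
  proof (cases w)
    case (Cons a v)
    have "Measurable.pred borel (\<lambda>x. \<lfloor>1 / (gauss_map ^^ n) x\<rfloor> = a \<and> cf_word n x = v)" by measurable
    then show ?thesis using Cons by (simp add: pred_def)
  qed simp
qed simp

lemma cf_word_measurable [measurable]: "cf_word n \<in> measurable borel (count_space UNIV)"
  by (subst measurable_count_space_eq2_countable)
     (auto simp: vimage_def cf_word_eq_borel)

lemma cylinder_borel [measurable]: "cylinder w \<in> sets borel"
proof -
  have "cylinder w = irr \<inter> {x. cf_word (length w) x = w}" by (auto simp: cylinder_def)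
  then show ?thesis using cf_word_eq_borel by auto
qed

lemma cylinder_eq_empty: "\<not> digits w \<Longrightarrow> cylinder w = {}"
  using digits_cf_word[where n = "length w"] by (auto simp: cylinder_def)

lemma cylinder_sub: "cylinder w \<subseteq> closed_segment (cf_eval w 0) (cf_eval w 1)"
proof
  fix x assume "x \<in> cylinder w"
  then have x: "x \<in> irr" "cf_word (length w) x = w" by (auto simp: cylinder_def)
  have "(gauss_map ^^ length w) x \<in> irr" using gauss_iter_irr x by blast
  moreover have "cf_eval w ((gauss_map ^^ length w) x) = x" using cf_eval_cf_word[OF x(1)] x(2) by metis
  moreover have "digits w" using digits_cf_word[OF x(1)] x(2) by metis
  ultimately show "x \<in> closed_segment (cf_eval w 0) (cf_eval w 1)"
    using cf_eval_between[of w 0 "(gauss_map ^^ length w) x" 1] by (auto simp: irr_def)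
qed

lemma cylinder_super:
  assumes "digits w"
  shows "open_segment (cf_eval w 0) (cf_eval w 1) - \<rat> \<subseteq> cylinder w"
proof
  fix x assume x: "x \<in> open_segment (cf_eval w 0) (cf_eval w 1) - \<rat>"
  then obtain y where y: "0 < y" "y < 1" "x = cf_eval w y"
    using cf_eval_surj_open_segment[OF assms, of 0 1 x] by auto
  then have "x \<in> irr" using x cf_eval_pos cf_eval_less_1 assms by (auto simp: irr_def)
  then show "x \<in> cylinder w" using cf_word_unique y assms by (auto simp: cylinder_def)
qed

text \<open>The cylinder lies between a closed segment and the open segment without the rationals,
  which have equal measure; \<open>cf_eval_diff\<close> at 0 and 1 gives the length.\<close>

lemma emeasure_cylinder:
  assumes "digits w"
  shows "emeasure lborel (cylinder w) = ennreal (1 / (continuant w * (continuant w + prev_continuant w)))"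
proof -
  define a b where "a = cf_eval w 0" and "b = cf_eval w 1"
  have d: "\<bar>a - b\<bar> = 1 / (continuant w * (continuant w + prev_continuant w))"
    unfolding a_def b_def using cf_eval_diff[OF assms, of 0 1] by simp
  have cl: "emeasure lborel (closed_segment a b) = ennreal \<bar>a - b\<bar>"
    by (simp add: closed_segment_eq_real_ivl)
  have "AE x in lborel. x \<notin> (\<rat> :: real set)"
    by (intro AE_not_in countable_imp_null_set_lborel countable_rat)
  moreover have "open_segment a b \<in> sets lborel" "(\<rat> :: real set) \<in> sets lborel"
    by (simp_all add: open_segment_eq_real_ivl sets.countable[OF _ countable_rat])
  ultimately have "emeasure lborel (open_segment a b - \<rat>) = emeasure lborel (open_segment a b)"
    by (intro emeasure_eq_AE sets.Diff) auto
  also have "\<dots> = ennreal \<bar>a - b\<bar>"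
    by (simp add: open_segment_eq_real_ivl)
  finally have "ennreal \<bar>a - b\<bar> \<le> emeasure lborel (cylinder w)"
    using emeasure_mono[OF cylinder_super[OF assms], of lborel, folded a_def b_def] by simp
  moreover have "emeasure lborel (cylinder w) \<le> ennreal \<bar>a - b\<bar>"
    using emeasure_mono[OF cylinder_sub, of w lborel, folded a_def b_def] cl by (simp add: closed_segment_eq_real_ivl)
  ultimately show ?thesis using d by simp
qed

lemma emeasure_cylinder_ones:
  "emeasure lborel (cylinder (replicate j 1 @ w)) \<le> ennreal ((1/2) ^ j) * emeasure lborel (cylinder w)"
proof (cases "digits w")
  case False
  then show ?thesis by (subst cylinder_eq_empty) auto
next
  case True
  show ?thesis
  proof (induction j)
    case (Suc j)
    let ?v = "replicate j 1 @ w"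
    let ?q = "continuant ?v" and ?r = "prev_continuant ?v"
    have d: "digits ?v" "digits (1 # ?v)" using True by auto
    have q: "1 \<le> ?q" "0 \<le> ?r" using continuant_bounds[OF d(1)] by auto
    \<comment> \<open>A new digit 1 replaces \<open>(q, r)\<close> by \<open>(q + r, q)\<close>, so
      the measure shrinks by the factor \<open>q / (2 q + r) \<le> 1/2\<close>.\<close>
    have "?q * (?q + ?r) * 2 \<le> (?q + ?r) * (?q + ?r + ?q)"
      using q by (simp add: algebra_simps)
    then have "1 / ((?q + ?r) * (?q + ?r + ?q)) \<le> 1 / (?q * (?q + ?r) * 2)"
      using q by (intro divide_left_mono) auto
    then have "1 / ((?q + ?r) * (?q + ?r + ?q)) \<le> 1 / 2 * (1 / (?q * (?q + ?r)))"
      by (simp add: mult.commute)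
    then have "emeasure lborel (cylinder (1 # ?v)) \<le> ennreal (1/2) * emeasure lborel (cylinder ?v)"
      unfolding emeasure_cylinder[OF d(1)] emeasure_cylinder[OF d(2)] using q
      by (subst ennreal_mult[symmetric]) (auto simp: continuant_Cons intro!: ennreal_leI)
    also have "\<dots> \<le> ennreal (1/2) * (ennreal ((1/2) ^ j) * emeasure lborel (cylinder w))"
      by (intro mult_left_mono Suc) auto
    also have "\<dots> = ennreal ((1/2) ^ Suc j) * emeasure lborel (cylinder w)"
      by (simp only: mult.assoc[symmetric] power_Suc) (subst ennreal_mult; simp)
    finally show ?case by simp
  qed simp
qed

definition ones_block :: "nat \<Rightarrow> nat \<Rightarrow> real set" where
  "ones_block n j = {x \<in> irr. cf_word (n + j) x = replicate j 1 @ cf_word n x}"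

lemma cf_word_drop: "drop j (cf_word (n + j) x) = cf_word n x"
  by (induction j) auto

lemma ones_block_eq: "ones_block n j = (\<Union>w\<in>{w. length w = n}. cylinder (replicate j 1 @ w))"
proof safe
  fix x assume "x \<in> ones_block n j"
  then show "x \<in> (\<Union>w\<in>{w. length w = n}. cylinder (replicate j 1 @ w))"
    by (intro UN_I[of "cf_word n x"]) (auto simp: ones_block_def cylinder_def add.commute)
next
  fix x and w :: "int list" assume "x \<in> cylinder (replicate j 1 @ w)" "n = length w"
  then show "x \<in> ones_block (length w) j"
    using cf_word_drop[of j "length w" x] by (auto simp: ones_block_def cylinder_def add.commute)
qed

lemma ones_block_borel [measurable]: "ones_block n j \<in> sets borel"
  unfolding ones_block_eq by (intro sets.countable_UN') auto

text \<open>Sum the estimate for a single cylinder over the disjoint cylinders of order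
  \<open>n\<close>, whose total measure is at most 1.\<close>

lemma emeasure_ones_block: "emeasure lborel (ones_block n j) \<le> ennreal ((1/2) ^ j)"
proof -
  let ?W = "{w :: int list. length w = n}"
  have cyl: "disjoint_family_on cylinder {w. length w = k}" for k
    by (auto simp: disjoint_family_on_def cylinder_def)
  have "disjoint_family_on (\<lambda>w. cylinder (replicate j 1 @ w)) ?W"
    by (auto simp: disjoint_family_on_def cylinder_def)
  then have "emeasure lborel (ones_block n j) = (\<integral>\<^sup>+w. emeasure lborel (cylinder (replicate j 1 @ w)) \<partial>count_space ?W)"
    unfolding ones_block_eq by (intro emeasure_UN_countable) auto
  also have "\<dots> \<le> (\<integral>\<^sup>+w. ennreal ((1/2) ^ j) * emeasure lborel (cylinder w) \<partial>count_space ?W)"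
    by (intro nn_integral_mono emeasure_cylinder_ones)
  also have "\<dots> = ennreal ((1/2) ^ j) * (\<integral>\<^sup>+w. emeasure lborel (cylinder w) \<partial>count_space ?W)"
    by (intro nn_integral_cmult) auto
  also have "(\<integral>\<^sup>+w. emeasure lborel (cylinder w) \<partial>count_space ?W) = emeasure lborel (\<Union>(cylinder ` ?W))"
    by (intro emeasure_UN_countable[symmetric] cyl) auto
  also have "\<dots> \<le> emeasure lborel {0..1::real}"
    by (intro emeasure_mono) (auto simp: cylinder_def irr_def)
  also have "\<dots> = 1" by simp
  finally show ?thesis by (simp add: mult_left_mono)
qed

section \<open>Convergence to the target\<close>

text \<open>The deterministic part, along one point: \<open>s n\<close> is the partial sum,
  \<open>\<tau> n\<close> the target attached to level \<open>n\<close> (felt at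
  \<open>n + 1\<close>), and \<open>\<rho> n\<close> stands for
  \<open>q\<^sub>n\<^sub>+\<^sub>1 / q\<^sub>n\<close>.\<close>

lemma steered_sequence_tendsto:
  fixes s \<tau> \<rho> t :: "nat \<Rightarrow> real" and a :: "nat \<Rightarrow> int" and N :: "nat \<Rightarrow> nat"
  assumes big: "\<And>n. 2 \<le> a (Suc n) \<Longrightarrow> s (Suc n) = \<tau> n"
    and one: "\<And>n. a (Suc (Suc n)) < 2 \<Longrightarrow> s (Suc (Suc n)) = s (Suc n) - \<rho> n * (\<tau> n - s (Suc n))"
    and \<rho>: "\<And>n. 0 \<le> \<rho> n" "\<And>n. a (Suc n) < 2 \<Longrightarrow> \<rho> n \<le> 2"
    and N: "\<And>k. N k + k < N (Suc k)"
    and \<tau>: "\<And>k n. N k \<le> n \<Longrightarrow> n < N (Suc k) \<Longrightarrow> \<tau> n = t k"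
    and exit: "\<And>k. K \<le> k \<Longrightarrow> \<exists>i. N k < i \<and> i \<le> N k + k \<and> 2 \<le> a i"
    and near: "\<And>k. K \<le> k \<Longrightarrow> \<bar>f - t k\<bar> \<le> (1/9) ^ k"
  shows "s \<longlonglongrightarrow> f"
proof -
  \<comment> \<open>Once the target is hit it is kept: a digit 1 only adds a multiple of
    \<open>\<tau> n - s (Suc n)\<close>, which is 0. The endpoint \<open>N (Suc k)\<close> is
    included because the target felt there belongs to the level before.\<close>
  have settled: "s n = t k" if "N k < i" "2 \<le> a i" "i \<le> n" "n \<le> N (Suc k)" for k i n
    using that(3,4)
  proof (induction n rule: dec_induct)
    case base
    then show ?case using big[of "i - 1"] \<tau>[of k "i - 1"] that(1,2) by simp
  next
    case (step n)
    have "0 < n" using that(1) step.hyps by linarith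
    then obtain n' where n': "n = Suc n'" by (cases n) auto
    have 1: "s n = t k" using step by simp
    have 2: "\<tau> n = t k" "\<tau> n' = t k" using step that(1) n' by (auto intro: \<tau>)
    show ?case
    proof (cases "2 \<le> a (Suc n)")
      case True then show ?thesis using big 2 by simp
    next
      case False then show ?thesis using one[of n'] 1 2 n' by simp
    qed
  qed
  have block: "\<bar>s n - t (Suc k)\<bar> \<le> 3 ^ Suc k * \<bar>t k - t (Suc k)\<bar>"
    if k: "K \<le> k" and n: "N (Suc k) \<le> n" "n \<le> N (Suc (Suc k))" for k n
  proof -
    let ?m = "N (Suc k)" and ?D = "\<bar>t k - t (Suc k)\<bar>"
    obtain i0 where "N k < i0" "i0 \<le> N k + k" "2 \<le> a i0" using exit[OF k] by blast
    then have start: "s ?m = t k" using settled[of k i0 ?m] N[of k] by simp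
    have ones: "\<bar>s (?m + i) - t (Suc k)\<bar> \<le> 3 ^ i * ?D"
      if "\<And>l. ?m < l \<Longrightarrow> l \<le> ?m + i \<Longrightarrow> a l < 2" "?m + i \<le> N (Suc (Suc k))" for i
      using that
    proof (induction i)
      case 0 show ?case using start by simp
    next
      case (Suc i)
      have IH: "\<bar>s (?m + i) - t (Suc k)\<bar> \<le> 3 ^ i * ?D"
        using Suc by (intro Suc.IH) auto
      obtain n' where n': "?m + i = Suc n'" using N[of k] by (cases "?m + i") auto
      have s: "s (Suc (Suc n')) = s (Suc n') - \<rho> n' * (\<tau> n' - s (Suc n'))"
        using Suc.prems(1)[of "Suc (Suc n')"] n' by (intro one) auto
      show ?case
      proof (cases "i = 0")
        case True
        \<comment> \<open>The first digit 1 of the block still refers to the last level of the old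
          block, so the sum stays at \<open>t k\<close>. The digit at \<open>?m\<close> itself may
          be large, hence \<open>\<rho> n'\<close> has no bound here.\<close>
        have "\<tau> n' = t k" using True n' N[of k] by (intro \<tau>) auto
        then have "s (?m + Suc i) = t k" using s start True n' by simp
        then show ?thesis by (simp add: True)
      next
        case False
        have "\<tau> n' = t (Suc k)" using False n' Suc.prems(2) by (intro \<tau>) auto
        moreover have "\<rho> n' \<le> 2" using False n' Suc.prems(1)[of "Suc n'"] by (intro \<rho>(2)) auto
        ultimately have "s (?m + Suc i) - t (Suc k) = (1 + \<rho> n') * (s (?m + i) - t (Suc k))"
          using s n' by (simp add: algebra_simps)
        then have "\<bar>s (?m + Suc i) - t (Suc k)\<bar> = (1 + \<rho> n') * \<bar>s (?m + i) - t (Suc k)\<bar>"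
          using \<rho>(1)[of n'] by (simp add: abs_mult)
        also have "\<dots> \<le> 3 * (3 ^ i * ?D)"
          using \<open>\<rho> n' \<le> 2\<close> \<rho>(1)[of n'] IH by (intro mult_mono) auto
        finally show ?thesis by simp
      qed
    qed
    show ?thesis
    proof (cases "\<exists>i. ?m < i \<and> i \<le> n \<and> 2 \<le> a i")
      case True
      then have "s n = t (Suc k)" using settled n by blast
      then show ?thesis by simp
    next
      case False
      \<comment> \<open>No large digit up to \<open>n\<close> means that \<open>n\<close> comes
        before this \<open>i\<close>, so at most \<open>Suc k\<close> factors 3 occur.\<close>
      obtain i where i: "?m < i" "i \<le> ?m + Suc k" "2 \<le> a i" using exit[of "Suc k"] k by auto
      then have "n - ?m \<le> Suc k" using False n by (cases "i \<le> n") auto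
      moreover have "\<bar>s (?m + (n - ?m)) - t (Suc k)\<bar> \<le> 3 ^ (n - ?m) * ?D"
        using False n by (intro ones) (auto simp: not_le)
      moreover have "(3::real) ^ (n - ?m) * ?D \<le> 3 ^ Suc k * ?D"
        using calculation(1) by (intro mult_right_mono power_increasing) auto
      ultimately show ?thesis using n by simp
    qed
  qed
  \<comment> \<open>The block estimate contributes
    \<open>3 ^ Suc k * 2 * (1/9) ^ k = 6 * (1/3) ^ k\<close>, the error of \<open>t (Suc k)\<close>
    at most \<open>(1/3) ^ k\<close>.\<close>
  have close: "\<bar>s n - f\<bar> \<le> 10 * (1/3) ^ k" if k: "K \<le> k" and n: "N (Suc k) \<le> n" "n \<le> N (Suc (Suc k))" for k n
  proof -
    have p: "(1/9::real) ^ Suc k \<le> (1/9) ^ k" by (intro power_decreasing) auto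
    have "\<bar>t k - t (Suc k)\<bar> \<le> 2 * (1/9) ^ k"
      using near[OF k] near[of "Suc k"] k p by linarith
    then have "3 ^ Suc k * \<bar>t k - t (Suc k)\<bar> \<le> 3 ^ Suc k * (2 * (1/9) ^ k)"
      by (intro mult_left_mono) auto
    also have "\<dots> = 6 * (3 * (1/9)) ^ k" unfolding power_mult_distrib by simp
    finally have "\<bar>s n - t (Suc k)\<bar> \<le> 6 * (1/3) ^ k" using block[OF that] by simp
    moreover have "(1/9::real) ^ k \<le> (1/3) ^ k" by (intro power_mono) auto
    ultimately show ?thesis using near[of "Suc k"] k p by linarith
  qed
  have mono: "strict_mono N" using N by (subst strict_mono_Suc_iff) (meson le_add1 le_less_trans)
  show ?thesis
  proof (rule LIMSEQ_I)
    fix e :: real assume e: "0 < e"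
    have "(\<lambda>k. 10 * (1/3::real) ^ k) \<longlonglongrightarrow> 10 * 0"
      by (intro tendsto_intros LIMSEQ_power_zero) auto
    then have "\<forall>\<^sub>F k in sequentially. 10 * (1/3::real) ^ k < e"
      using e by (intro order_tendstoD) auto
    then obtain J where J: "\<And>k. J \<le> k \<Longrightarrow> 10 * (1/3::real) ^ k < e"
      by (auto simp: eventually_sequentially)
    show "\<exists>no. \<forall>n\<ge>no. norm (s n - f) < e"
    proof (intro exI[of _ "N (Suc (max J K))"] allI impI)
      fix n assume n: "N (Suc (max J K)) \<le> n"
      \<comment> \<open>The block containing \<open>n\<close>; it exists because
        \<open>k \<le> N k\<close> bounds the candidates by \<open>n\<close>.\<close>
      define k where "k = (GREATEST k. N k \<le> n)"
      have bd: "\<And>y. N y \<le> n \<Longrightarrow> y \<le> n" using strict_mono_imp_increasing[OF mono] le_trans by blast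
      have k1: "N k \<le> n" unfolding k_def by (rule GreatestI_nat[where P="\<lambda>k. N k \<le> n", OF n bd])
      have k2: "Suc (max J K) \<le> k" unfolding k_def by (rule Greatest_le_nat[where P="\<lambda>k. N k \<le> n", OF n bd])
      have k3: "n < N (Suc k)"
      proof (rule ccontr)
        assume "\<not> n < N (Suc k)"
        then have "Suc k \<le> k" unfolding k_def by (intro Greatest_le_nat[where P="\<lambda>k. N k \<le> n", OF _ bd]) auto
        then show False by simp
      qed
      obtain k' where k': "k = Suc k'" "max J K \<le> k'" using k2 by (cases k) auto
      have "\<bar>s n - f\<bar> \<le> 10 * (1/3) ^ k'" using k1 k3 k' by (intro close) auto
      then show "norm (s n - f) < e" using J[of k'] k' by simp
    qed
  qed
qed

section \<open>Approximation in measure by cylinder functions\<close>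

lemma finite_measure_unit_lebesgue: "finite_measure unit_lebesgue"
  by (rule finite_measureI) (simp add: emeasure_restrict_space space_restrict_space)

lemma (in finite_measure) AE_tendsto_zero_imp_tendsto_measure:
  fixes u :: "nat \<Rightarrow> 'a \<Rightarrow> real"
  assumes [measurable]: "\<And>n. u n \<in> borel_measurable M"
    and lim: "AE x in M. (\<lambda>n. u n x) \<longlonglongrightarrow> 0" and "0 < \<delta>"
  shows "(\<lambda>n. measure M {x \<in> space M. \<delta> < \<bar>u n x\<bar>}) \<longlonglongrightarrow> 0"
proof -
  let ?A = "\<lambda>n. {x \<in> space M. \<delta> < \<bar>u n x\<bar>}"
  have "(\<lambda>n. \<integral>x. indicator (?A n) x \<partial>M) \<longlonglongrightarrow> (\<integral>x. 0 \<partial>M :: real)"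
  proof (rule integral_dominated_convergence[where w = "\<lambda>_. 1"])
    show "AE x in M. (\<lambda>n. indicator (?A n) x :: real) \<longlonglongrightarrow> 0"
      using lim
    proof eventually_elim
      case (elim x)
      then have "\<forall>\<^sub>F n in sequentially. \<bar>u n x\<bar> < \<delta>"
        using \<open>0 < \<delta>\<close> by (intro order_tendstoD(2)[OF tendsto_rabs_zero])
      then have "\<forall>\<^sub>F n in sequentially. indicator (?A n) x = (0::real)"
        by eventually_elim auto
      then show ?case by (rule tendsto_eventually)
    qed
  qed (auto simp: indicator_def)
  then show ?thesis by (simp add: Int_absorb2)
qed

text \<open>The value at 0 is the convergent; its error is at most \<open>1 / n\<close> because
  \<open>q\<^sub>n \<ge> n\<close>.\<close>

lemma cf_eval_cf_word_tendsto:
  assumes "x \<in> irr"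
  shows "(\<lambda>n. cf_eval (cf_word n x) 0) \<longlonglongrightarrow> x"
proof -
  have bound: "\<bar>cf_eval (cf_word n x) 0 - x\<bar> \<le> inverse (real n)" if "0 < n" for n
  proof -
    let ?w = "cf_word n x" and ?y = "(gauss_map ^^ n) x"
    let ?q = "continuant ?w" and ?r = "prev_continuant ?w"
    have y: "0 < ?y" "?y < 1" using gauss_iter_irr[OF assms, of n] by (auto simp: irr_def)
    have q: "1 \<le> ?q" "n \<le> ?q" "0 \<le> ?r"
      using continuant_bounds[OF digits_cf_word[OF assms, of n]] by auto
    have "\<bar>cf_eval ?w 0 - x\<bar> = ?y / (?q * (?q + ?r * ?y))"
      using cf_eval_diff[OF digits_cf_word[OF assms], of 0 ?y n] y cf_eval_cf_word[OF assms, of n] by simp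
    also have "\<dots> \<le> 1 / (real n * 1)"
      using y q that by (intro frac_le mult_mono) (auto intro: add_increasing2)
    finally show ?thesis by (simp add: inverse_eq_divide)
  qed
  have "(\<lambda>n. cf_eval (cf_word n x) 0 - x) \<longlonglongrightarrow> 0"
    by (rule Lim_null_comparison[OF _ lim_inverse_n])
       (use bound in \<open>auto simp: eventually_sequentially intro!: exI[of _ 1]\<close>)
  then show ?thesis by (simp add: LIM_zero_iff)
qed

lemma AE_unit_lebesgue_irr: "AE x in unit_lebesgue. x \<in> irr"
proof -
  have "AE x in lborel. x \<notin> (\<rat> :: real set)"
    by (intro AE_not_in countable_imp_null_set_lborel countable_rat)
  then have "AE x in lborel. x \<in> {0..<1} \<longrightarrow> x \<in> irr"
    by (rule eventually_mono) (auto simp: irr_def less_le)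
  then show ?thesis
    by (subst AE_restrict_space_iff) auto
qed

lemma word_function_measurable:
  fixes g :: "int list \<Rightarrow> real"
  shows "(\<lambda>x. g (cf_word n x)) \<in> borel_measurable unit_lebesgue"
  by (intro measurable_restrict_space1 measurable_compose[OF _ measurable_count_space]) simp

text \<open>First a continuous \<open>g j\<close> approximates \<open>f\<close>, then its value at
  the convergent approximates \<open>g j\<close>; each takes half of \<open>\<delta>\<close> and
  \<open>\<epsilon>\<close>. Validity for all large \<open>n\<close> leaves the levels free to be
  spaced out later.\<close>

lemma approx_in_measure_by_words:
  fixes f :: "real \<Rightarrow> real"
  assumes f: "f \<in> borel_measurable borel" and "0 < \<delta>" "0 < \<epsilon>"
  shows "\<exists>m. \<forall>n\<ge>m. \<exists>T. measure unit_lebesgue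
    {x \<in> space unit_lebesgue. \<delta> < \<bar>f x - T (cf_word n x)\<bar>} \<le> \<epsilon>"
proof -
  interpret finite_measure unit_lebesgue by (rule finite_measure_unit_lebesgue)
  \<comment> \<open>Lebesgue measurability is equivalent to \<open>measurable_on\<close>, which
    provides continuous functions converging off a negligible set.\<close>
  have "f \<in> borel_measurable lebesgue"
    using f by (intro measurable_completion) simp
  then have "f measurable_on UNIV"
    using measurable_on_iff_borel_measurable[of UNIV f] by simp
  then obtain N g where N: "negligible N" and g: "\<And>n. continuous_on UNIV (g n)"
    and lim: "\<And>x. x \<notin> N \<Longrightarrow> (\<lambda>n. g n x) \<longlonglongrightarrow> f x"
    unfolding measurable_on_def by auto
  have g_meas: "g j \<in> borel_measurable unit_lebesgue" for j
    using borel_measurable_continuous_onI[OF g[of j]] by (intro measurable_restrict_space1) simp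
  have f_meas: "f \<in> borel_measurable unit_lebesgue"
    using f by (intro measurable_restrict_space1) simp
  note [measurable] = g_meas f_meas word_function_measurable
  have "AE x in lebesgue. x \<notin> N"
    using N by (intro AE_not_in) (simp add: negligible_iff_null_sets)
  then have "AE x in lborel. x \<notin> N" by (simp add: AE_completion_iff)
  then have "AE x in unit_lebesgue. (\<lambda>j. f x - g j x) \<longlonglongrightarrow> 0"
    by (subst AE_restrict_space_iff)
       (auto elim!: eventually_mono intro!: tendsto_eq_intros lim)
  then have "(\<lambda>j. measure unit_lebesgue {x \<in> space unit_lebesgue. \<delta>/2 < \<bar>f x - g j x\<bar>}) \<longlonglongrightarrow> 0"
    using \<open>0 < \<delta>\<close> by (intro AE_tendsto_zero_imp_tendsto_measure) auto
  then have "\<forall>\<^sub>F j in sequentially. measure unit_lebesgue {x \<in> space unit_lebesgue. \<delta>/2 < \<bar>f x - g j x\<bar>} < \<epsilon>/2"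
    using \<open>0 < \<epsilon>\<close> by (intro order_tendstoD) auto
  then obtain j where j: "measure unit_lebesgue {x \<in> space unit_lebesgue. \<delta>/2 < \<bar>f x - g j x\<bar>} < \<epsilon>/2"
    by (auto simp: eventually_sequentially)
  let ?G = "\<lambda>n x. g j (cf_eval (cf_word n x) 0)"
  have [measurable]: "?G n \<in> borel_measurable unit_lebesgue" for n
    by (rule word_function_measurable)
  have "AE x in unit_lebesgue. (\<lambda>n. g j x - ?G n x) \<longlonglongrightarrow> 0"
    using AE_unit_lebesgue_irr
  proof eventually_elim
    case (elim x)
    have "isCont (g j) x" using g by (simp add: continuous_on_eq_continuous_at)
    then have "(\<lambda>n. ?G n x) \<longlonglongrightarrow> g j x"
      by (rule isCont_tendsto_compose[OF _ cf_eval_cf_word_tendsto[OF elim]])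
    then show ?case by (auto intro!: tendsto_eq_intros)
  qed
  then have "(\<lambda>n. measure unit_lebesgue {x \<in> space unit_lebesgue. \<delta>/2 < \<bar>g j x - ?G n x\<bar>}) \<longlonglongrightarrow> 0"
    using \<open>0 < \<delta>\<close> by (intro AE_tendsto_zero_imp_tendsto_measure) auto
  then have "\<forall>\<^sub>F n in sequentially. measure unit_lebesgue {x \<in> space unit_lebesgue. \<delta>/2 < \<bar>g j x - ?G n x\<bar>} < \<epsilon>/2"
    using \<open>0 < \<epsilon>\<close> by (intro order_tendstoD) auto
  then obtain m where m: "\<And>n. m \<le> n \<Longrightarrow>
      measure unit_lebesgue {x \<in> space unit_lebesgue. \<delta>/2 < \<bar>g j x - ?G n x\<bar>} < \<epsilon>/2"
    by (auto simp: eventually_sequentially)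
  show ?thesis
  proof (intro exI[of _ m] allI impI exI[of _ "\<lambda>w. g j (cf_eval w 0)"])
    fix n assume n: "m \<le> n"
    have "measure unit_lebesgue {x \<in> space unit_lebesgue. \<delta> < \<bar>f x - ?G n x\<bar>} \<le>
      measure unit_lebesgue ({x \<in> space unit_lebesgue. \<delta>/2 < \<bar>f x - g j x\<bar>} \<union>
        {x \<in> space unit_lebesgue. \<delta>/2 < \<bar>g j x - ?G n x\<bar>})"
    proof (rule finite_measure_mono)
      show "{x \<in> space unit_lebesgue. \<delta> < \<bar>f x - ?G n x\<bar>} \<subseteq>
        {x \<in> space unit_lebesgue. \<delta>/2 < \<bar>f x - g j x\<bar>} \<union>
        {x \<in> space unit_lebesgue. \<delta>/2 < \<bar>g j x - ?G n x\<bar>}"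
        by (auto simp: abs_real_def split: if_splits)
    qed measurable
    also have "\<dots> \<le> measure unit_lebesgue {x \<in> space unit_lebesgue. \<delta>/2 < \<bar>f x - g j x\<bar>} +
        measure unit_lebesgue {x \<in> space unit_lebesgue. \<delta>/2 < \<bar>g j x - ?G n x\<bar>}"
      by (intro measure_Un_le) measurable
    also have "\<dots> \<le> \<epsilon>" using j m[OF n] by simp
    finally show "measure unit_lebesgue {x \<in> space unit_lebesgue. \<delta> < \<bar>f x - ?G n x\<bar>} \<le> \<epsilon>" .
  qed
qed

section \<open>Choice of levels and targets\<close>

lemma ones_blockI:
  assumes "x \<in> irr" "\<And>i. n < i \<Longrightarrow> i \<le> n + j \<Longrightarrow> hd (cf_word i x) < 2"
  shows "x \<in> ones_block n j"
  using assms(2)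
proof (induction j)
  case 0 then show ?case using assms(1) by (simp add: ones_block_def)
next
  case (Suc j)
  have "hd (cf_word (Suc (n + j)) x) = 1"
    using Suc.prems[of "Suc (n + j)"] digit_ge_1[OF assms(1), of "n + j"]
    by (simp del: one_le_floor floor_less_numeral)
  then show ?case using Suc by (auto simp: ones_block_def)
qed

lemma steer_tendsto:
  fixes N :: "nat \<Rightarrow> nat"
  assumes x: "x \<in> irr"
    and N: "\<And>k. N k + k < N (Suc k)"
    and T: "\<And>k n. N k \<le> n \<Longrightarrow> n < N (Suc k) \<Longrightarrow> T (cf_word n x) = t k"
    and ones: "\<forall>\<^sub>F k in sequentially. x \<notin> ones_block (N k) k"
    and near: "\<forall>\<^sub>F k in sequentially. \<bar>f - t k\<bar> \<le> (1/9) ^ k"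
  shows "(\<lambda>n. steer T (cf_word n x)) \<longlonglongrightarrow> f"
proof -
  obtain K where K: "\<And>k. K \<le> k \<Longrightarrow> x \<notin> ones_block (N k) k \<and> \<bar>f - t k\<bar> \<le> (1/9) ^ k"
    using eventually_conj[OF ones near] by (auto simp: eventually_sequentially)
  let ?\<rho> = "\<lambda>n. continuant (cf_word (Suc n) x) / continuant (cf_word n x)"
  have q: "1 \<le> continuant (cf_word n x)" "prev_continuant (cf_word n x) \<le> continuant (cf_word n x)" for n
    using continuant_bounds[OF digits_cf_word[OF x]] by auto
  show ?thesis
  proof (rule steered_sequence_tendsto[where a = "\<lambda>n. hd (cf_word n x)" and \<tau> = "\<lambda>n. T (cf_word n x)"
      and \<rho> = ?\<rho> and N = N and t = t and K = K])
    show "0 \<le> ?\<rho> n" for n using q(1)[of n] q(1)[of "Suc n"] by (intro divide_nonneg_nonneg) linarith+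
    show "?\<rho> n \<le> 2" if "hd (cf_word (Suc n) x) < 2" for n
    proof -
      have "\<lfloor>1 / (gauss_map ^^ n) x\<rfloor> = 1" using that digit_ge_1[OF x, of n]
        by (simp del: one_le_floor floor_less_numeral)
      then show ?thesis using q[of n] by (simp add: continuant_Cons field_simps)
    qed
    show "\<exists>i>N k. i \<le> N k + k \<and> 2 \<le> hd (cf_word i x)" if "K \<le> k" for k
      using K[OF that] ones_blockI[OF x, of "N k" k] by (meson not_le)
    show "\<bar>f - t k\<bar> \<le> (1/9) ^ k" if "K \<le> k" for k using K[OF that] by blast
    show "steer T (cf_word (Suc n) x) = T (cf_word n x)" if "2 \<le> hd (cf_word (Suc n) x)" for n
      using that by simp
    show "steer T (cf_word (Suc (Suc n)) x) = steer T (cf_word (Suc n) x) -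
        ?\<rho> n * (T (cf_word n x) - steer T (cf_word (Suc n) x))" if "hd (cf_word (Suc (Suc n)) x) < 2" for n
      using that unfolding cf_word.simps list.sel steer.simps(2)[of T "\<lfloor>1 / (gauss_map ^^ Suc n) x\<rfloor>"]
      by (simp del: steer.simps floor_less_numeral numeral_le_floor funpow.simps)
  qed (rule N, rule T)
qed

lemma exists_steering:
  fixes f :: "real \<Rightarrow> real"
  assumes f: "f \<in> borel_measurable borel"
  shows "\<exists>T. AE x in unit_lebesgue. x \<in> irr \<and> (\<lambda>n. steer T (cf_word n x)) \<longlonglongrightarrow> f x"
proof -
  interpret finite_measure unit_lebesgue by (rule finite_measure_unit_lebesgue)
  define A :: "nat \<Rightarrow> nat \<Rightarrow> (int list \<Rightarrow> real) \<Rightarrow> real set"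
    where "A k n U = {x \<in> space unit_lebesgue. (1/9) ^ k < \<bar>f x - U (cf_word n x)\<bar>}" for k n U
  have "\<forall>k. \<exists>m. \<forall>n\<ge>m. \<exists>U. measure unit_lebesgue (A k n U) \<le> (1/2) ^ k"
    unfolding A_def using approx_in_measure_by_words[OF f] by simp
  then obtain m where m: "\<And>k n. m k \<le> n \<Longrightarrow> \<exists>U. measure unit_lebesgue (A k n U) \<le> (1/2) ^ k"
    by metis
  \<comment> \<open>Each block leaves room for \<open>k\<close> digits, and
    \<open>N k \<ge> m k\<close> makes the approximation available at level
    \<open>N k\<close>.\<close>
  define N where "N = rec_nat (m 0) (\<lambda>k r. r + k + 1 + m (Suc k))"
  have N_Suc: "N (Suc k) = N k + k + 1 + m (Suc k)" for k by (simp add: N_def)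
  have mN: "m k \<le> N k" for k by (cases k) (auto simp: N_def)
  have N: "N k + k < N (Suc k)" for k by (simp add: N_Suc)
  have mono: "strict_mono N" by (subst strict_mono_Suc_iff) (simp add: N_Suc)
  obtain U where U: "\<And>k. measure unit_lebesgue (A k (N k) (U k)) \<le> (1/2) ^ k"
    using m[OF mN] by metis
  \<comment> \<open>The length of \<open>w\<close> determines its block; dropping the latest digits
    leaves the word of the first \<open>N k\<close>, on which \<open>U k\<close> is
    evaluated.\<close>
  define T where "T w = (let k = GREATEST k. N k \<le> length w in U k (drop (length w - N k) w))" for w
  have T: "T (cf_word n x) = U k (cf_word (N k) x)" if "N k \<le> n" "n < N (Suc k)" for k n x
  proof -
    have "(GREATEST k. N k \<le> n) = k"
    proof (rule Greatest_equality)
      fix y assume "N y \<le> n"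
      then have "N y < N (Suc k)" using that by simp
      then show "y \<le> k" using strict_mono_less[OF mono] by simp
    qed (rule that)
    then show ?thesis using cf_word_drop[of "n - N k" "N k" x] that by (simp add: T_def)
  qed
  have [measurable]: "f \<in> borel_measurable unit_lebesgue"
    using f by (intro measurable_restrict_space1) simp
  have [measurable]: "(\<lambda>x. U k (cf_word n x)) \<in> borel_measurable unit_lebesgue" for k n
    by (rule word_function_measurable)
  have geo: "summable (\<lambda>k. (1/2::real) ^ k)" by (rule summable_geometric) simp
  have near: "AE x in unit_lebesgue. \<forall>\<^sub>F k in sequentially. x \<in> space unit_lebesgue - A k (N k) (U k)"
  proof (rule borel_cantelli_AE1)
    show "summable (\<lambda>k. measure unit_lebesgue (A k (N k) (U k)))"
      by (rule summable_comparison_test'[OF geo]) (simp add: U)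
    show "A k (N k) (U k) \<in> sets unit_lebesgue" for k unfolding A_def by measurable
  qed (simp add: emeasure_eq_measure)
  let ?B = "\<lambda>k. ones_block (N k) k \<inter> {0..<1}"
  have Bsub: "?B k = ones_block (N k) k" for k by (auto simp: ones_block_def irr_def)
  have Bm: "?B k \<in> sets unit_lebesgue" for k by (auto simp: sets_restrict_space)
  have ones: "AE x in unit_lebesgue. \<forall>\<^sub>F k in sequentially. x \<in> space unit_lebesgue - ?B k"
  proof (rule borel_cantelli_AE1[OF Bm])
    have "measure unit_lebesgue (?B k) \<le> (1/2) ^ k" for k
    proof -
      have "emeasure unit_lebesgue (?B k) \<le> ennreal ((1/2) ^ k)"
        using emeasure_ones_block[of "N k" k] by (subst emeasure_restrict_space) (simp_all add: Bsub, auto simp: ones_block_def irr_def)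
      then show ?thesis by (simp add: emeasure_eq_measure)
    qed
    then show "summable (\<lambda>k. measure unit_lebesgue (?B k))"
      by (intro summable_comparison_test'[OF geo]) simp
  qed (auto simp: emeasure_eq_measure)
  have "AE x in unit_lebesgue. x \<in> irr \<and> (\<lambda>n. steer T (cf_word n x)) \<longlonglongrightarrow> f x"
    using AE_unit_lebesgue_irr near ones
  proof eventually_elim
    case (elim x)
    have "(\<lambda>n. steer T (cf_word n x)) \<longlonglongrightarrow> f x"
    proof (rule steer_tendsto[OF elim(1), where N = N and t = "\<lambda>k. U k (cf_word (N k) x)"])
      show "\<forall>\<^sub>F k in sequentially. x \<notin> ones_block (N k) k"
        using elim(3) by (rule eventually_mono) (use Bsub in auto)
      show "\<forall>\<^sub>F k in sequentially. \<bar>f x - U k (cf_word (N k) x)\<bar> \<le> (1/9) ^ k"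
        using elim(2) by (rule eventually_mono) (auto simp: A_def)
    qed (rule N, rule T)
    then show ?case using elim(1) by simp
  qed
  then show ?thesis by blast
qed

section \<open>Transfer to the circle\<close>

lemma circ_repr_measurable [measurable]: "circ_repr \<in> borel_measurable borel"
  unfolding borel_measurable_iff_greater
proof
  fix c :: real
  \<comment> \<open>Although \<open>circ_repr\<close> jumps at 0, its strict superlevel sets are
    open in the quotient topology.\<close>
  have "open (circ -` {\<alpha>. c < circ_repr \<alpha>})"
  proof (cases "0 \<le> c")
    case True
    have "circ -` {\<alpha>. c < circ_repr \<alpha>} = (\<Union>k::int. {of_int k + c<..<of_int k + 1})"
    proof (intro set_eqI iffI)
      fix x assume "x \<in> circ -` {\<alpha>. c < circ_repr \<alpha>}"
      then have "c < frac x" by (simp add: circ_repr.abs_eq)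
      then show "x \<in> (\<Union>k::int. {of_int k + c<..<of_int k + 1})"
        using frac_lt_1[of x] by (intro UN_I[of "\<lfloor>x\<rfloor>"]) (auto simp: frac_def)
    next
      fix x assume "x \<in> (\<Union>k::int. {of_int k + c<..<of_int k + 1})"
      then obtain k :: int where k: "of_int k + c < x" "x < of_int k + 1" by auto
      then have "\<lfloor>x\<rfloor> = k" using True by (simp add: floor_eq_iff)
      then show "x \<in> circ -` {\<alpha>. c < circ_repr \<alpha>}" using k by (simp add: circ_repr.abs_eq frac_def)
    qed
    then show ?thesis by auto
  next
    case False
    then have "circ -` {\<alpha>. c < circ_repr \<alpha>} = UNIV"
      using circ_repr_bounds(1) by (auto intro: less_le_trans[of c 0])
    then show ?thesis by simp
  qed
  then have "open {\<alpha>. c < circ_repr \<alpha>}" by (simp add: open_circle_def)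
  then show "{\<alpha> \<in> space borel. c < circ_repr \<alpha>} \<in> sets borel" by simp
qed

lemma circ_measurable_unit: "circ \<in> measurable unit_lebesgue borel"
  using measurable_circ by (intro measurable_restrict_space1) simp

text \<open>\<open>P\<close> may be non-measurable, so a measurable null set covering its failures
  is transported instead.\<close>

lemma AE_haarI:
  assumes "AE x in unit_lebesgue. P x"
  shows "AE \<alpha> in haar. P (circ_repr \<alpha>)"
proof -
  obtain Z where Z: "Z \<in> null_sets unit_lebesgue" "{x \<in> space unit_lebesgue. \<not> P x} \<subseteq> Z"
    using assms by (auto simp: eventually_ae_filter)
  then have Zb [measurable]: "Z \<in> sets borel"
    by (auto simp: null_sets_def sets_restrict_space)
  have "AE x in unit_lebesgue. circ_repr (circ x) \<notin> Z"
    using AE_not_in[OF Z(1)] AE_space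
    by eventually_elim (auto simp: circ_repr_circ space_restrict_space)
  then have "AE \<alpha> in haar. circ_repr \<alpha> \<notin> Z"
    unfolding haar_def by (subst AE_distr_iff[OF circ_measurable_unit]) measurable
  then show ?thesis
    by (rule eventually_mono) (use Z(2) circ_repr_bounds in \<open>auto simp: space_restrict_space\<close>)
qed

theorem theorem2:
  fixes F :: "circle \<Rightarrow> ereal"
  assumes "F \<in> borel_measurable borel"
    and "AE \<alpha> in haar. \<bar>F \<alpha>\<bar> \<noteq> \<infinity>"
  shows "\<exists>c :: circle \<Rightarrow> real.
    AE \<alpha> in haar. \<alpha> \<notin> rat_circle \<longrightarrow>
      (\<lambda>N. ereal (\<Sum>n=1..N. (-1) ^ (n - 1) * of_int (cf_q \<alpha> (n + 1)) *
                              (\<Sum>\<beta>\<in>cf_E n \<alpha>. c \<beta>)))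
        \<longlonglongrightarrow> F \<alpha>"
proof -
  have [measurable]: "F \<in> borel_measurable borel" by (rule assms(1))
  \<comment> \<open>Infinite values become 0; this changes \<open>F\<close> only on the null set
    excluded by the second assumption.\<close>
  have "(\<lambda>x. real_of_ereal (F (circ x))) \<in> borel_measurable borel" by measurable
  then obtain T where "AE x in unit_lebesgue. x \<in> irr \<and>
      (\<lambda>n. steer T (cf_word n x)) \<longlonglongrightarrow> real_of_ereal (F (circ x))"
    using exists_steering by blast
  then have "AE \<alpha> in haar. circ_repr \<alpha> \<in> irr \<and>
      (\<lambda>n. steer T (cf_word n (circ_repr \<alpha>))) \<longlonglongrightarrow> real_of_ereal (F (circ (circ_repr \<alpha>)))"
    by (rule AE_haarI)
  then have "AE \<alpha> in haar. (\<lambda>N. ereal (\<Sum>n=1..N. (-1) ^ (n - 1) * of_int (cf_q \<alpha> (n + 1)) *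
                              (\<Sum>\<beta>\<in>cf_E n \<alpha>. farey_coeff T \<beta>))) \<longlonglongrightarrow> F \<alpha>"
    using assms(2)
  proof eventually_elim
    case (elim \<alpha>)
    have "(\<lambda>n. ereal (steer T (cf_word n (circ_repr \<alpha>)))) \<longlonglongrightarrow> ereal (real_of_ereal (F \<alpha>))"
      using elim(1) by (simp add: circ_circ_repr)
    then have "(\<lambda>n. ereal (steer T (cf_word n (circ_repr \<alpha>)))) \<longlonglongrightarrow> F \<alpha>"
      using elim(2) by (simp only: ereal_real' not_False_eq_True)
    then show ?case
      using elim(1) by (simp only: partial_sum_eq_steer)
  qed
  then show ?thesis by (intro exI[of _ "farey_coeff T"]) (auto elim: eventually_mono)
qed

end
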